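(* Let $H\in C^0(\mathbb{R}^4)$ satisfy the coercivity condition (C) and the unimodality condition (U), and let $E\in\mathbb{R}$. (a) Always $\partial A_E\subseteq D_E=\{\mathcal{E}=E\}$. (b) If in addition $\mathcal{E}$ is $C^1$ near the boundary $\partial A_E$ and the base regularity condition (R) holds at $E$, then $\{\mathcal{E}<E\}=\operatorname{int}A_E$ and $$D_E=\partial A_E=\{\mathcal{E}=E\},$$ and $\pi_E$ is a two-sheeted covering over $\operatorname{int}A_E$. (c) Without (R) the equality $D_E=\partial A_E$ can fail: there exist $H$ and $E$ satisfying (C) and (U), with $\mathcal{E}\in C^1$ but (R) failing at $E$, for which $D_E$ contains a point of $\operatorname{int}A_E$.
   Context: Coordinates on $\mathbb{R}^4$ are $(q_1,q_2,p_1,p_2)$. Let $C=\{q_1=0\}$, with coordinates $(q_2,p_1,p_2)$, and $\pi\colon C\to\mathbb{R}^2$, $\pi(0,q_2,p_1,p_2)=b=(q_2,p_2)$. The fibre function is $h_b(p_1)=H(0,q_2,p_1,p_2)$. Put $\Sigma_E^{\mathrm{sec}}=\{(q_2,p_1,p_2): h_{b}(p_1)=E\}$, $\pi_E=\pi|_{\Sigma_E^{\mathrm{sec}}}$, admissible region $A_E=\pi_E(\Sigma_E^{\mathrm{sec}})\subseteq\mathbb{R}^2$, least-energy function $\mathcal{E}(b)=\inf_{p_1\in\mathbb{R}}h_b(p_1)$, critical locus $\mathrm{Crit}(\pi_E)=\{x\in\Sigma_E^{\mathrm{sec}}:\partial_{p_1}H(x)=0\}$ (where $\partial_{p_1}H(0,q_2,p_1,p_2)=h_b'(p_1)$),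 and discriminant $D_E=\pi_E(\mathrm{Crit}(\pi_E))$. Interior and boundary are taken in $\mathbb{R}^2$. Condition (C): $h_b(p_1)\to+\infty$ as $|p_1|\to\infty$, locally uniformly in $b$; that is, every $b_0\in\mathbb{R}^2$ has a neighbourhood $N$ such that for every $M$ there is $R$ with $h_b(p_1)>M$ for all $b\in N$ and $|p_1|>R$. Condition (U): for every $b$, $h_b\in C^1(\mathbb{R})$ and there is a unique $m(b)\in\mathbb{R}$ with $h_b'<0$ on $(-\infty,m(b))$ and $h_b'>0$ on $(m(b),\infty)$. Condition (R) at $E$: $E$ is a regular value of $\mathcal{E}\colon\mathbb{R}^2\to\mathbb{R}$, i.e. at every $b$ with $\mathcal{E}(b)=E$ the function $\mathcal{E}$ is differentiable with $d\mathcal{E}(b)\ne0$. *)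

theory Defs
  imports "HOL-Analysis.Analysis"
begin

(* Phase space is real * real * real * real with coordinates (q1, q2, p1, p2); the slice {q1 = 0}
   carries the coordinates (q2, p1, p2), and its base has the coordinates b = (q2, p2). *)

type_synonym hamiltonian = "real \<times> real \<times> real \<times> real \<Rightarrow> real"

definition fibre_fun :: "hamiltonian \<Rightarrow> real \<times> real \<Rightarrow> real \<Rightarrow> real" where
  "fibre_fun H b p1 = H (0, fst b, p1, snd b)"

definition base_proj :: "real \<times> real \<times> real \<Rightarrow> real \<times> real" where
  "base_proj = (\<lambda>(q2, p1, p2). (q2, p2))"

definition energy_slice :: "hamiltonian \<Rightarrow> real \<Rightarrow> (real \<times> real \<times> real) set" where
  "energy_slice H E = {(q2, p1, p2). fibre_fun H (q2, p2) p1 = E}"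

definition admissible :: "hamiltonian \<Rightarrow> real \<Rightarrow> (real \<times> real) set" where
  "admissible H E = base_proj ` energy_slice H E"

(* The infimum is taken in the reals, so this is meaningful only for fibre functions that are
   bounded below; coercive_fibres together with continuity of H guarantees this. *)
definition least_energy :: "hamiltonian \<Rightarrow> real \<times> real \<Rightarrow> real" where
  "least_energy H b = (INF p1. fibre_fun H b p1)"

definition crit_locus :: "hamiltonian \<Rightarrow> real \<Rightarrow> (real \<times> real \<times> real) set" where
  "crit_locus H E =
     {(q2, p1, p2). (q2, p1, p2) \<in> energy_slice H E \<and>
        (fibre_fun H (q2, p2) has_real_derivative 0) (at p1)}"

definition discriminant :: "hamiltonian \<Rightarrow> real \<Rightarrow> (real \<times> real) set" where
  "discriminant H E = base_proj ` crit_locus H E"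

definition coercive_fibres :: "hamiltonian \<Rightarrow> bool" where
  "coercive_fibres H \<longleftrightarrow>
     (\<forall>b0. \<exists>N. open N \<and> b0 \<in> N \<and>
        (\<forall>M. \<exists>R. \<forall>b\<in>N. \<forall>p1. \<bar>p1\<bar> > R \<longrightarrow> fibre_fun H b p1 > M))"

definition unimodal_fibres :: "hamiltonian \<Rightarrow> bool" where
  "unimodal_fibres H \<longleftrightarrow>
     (\<forall>b. fibre_fun H b C1_differentiable_on UNIV \<and>
        (\<exists>!m. (\<forall>p1<m. deriv (fibre_fun H b) p1 < 0) \<and>
              (\<forall>p1>m. deriv (fibre_fun H b) p1 > 0)))"

(* Intended for open S; the derivative is continuous in the operator norm.  The library's
   C1_differentiable_on covers functions of one real variable only. *)
definition C1_on_open :: "(real \<times> real \<Rightarrow> real) \<Rightarrow> (real \<times> real) set \<Rightarrow> bool" where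
  "C1_on_open f S \<longleftrightarrow>
     (\<exists>D :: real \<times> real \<Rightarrow> (real \<times> real) \<Rightarrow>\<^sub>L real.
        (\<forall>x\<in>S. (f has_derivative blinfun_apply (D x)) (at x)) \<and> continuous_on S D)"

definition regular_value :: "(real \<times> real \<Rightarrow> real) \<Rightarrow> real \<Rightarrow> bool" where
  "regular_value f E \<longleftrightarrow>
     (\<forall>b. f b = E \<longrightarrow> (\<exists>D. (f has_derivative D) (at b) \<and> D \<noteq> (\<lambda>v. 0)))"

definition two_sheeted_covering ::
  "'a::topological_space set \<Rightarrow> ('a \<Rightarrow> 'b::topological_space) \<Rightarrow> 'b set \<Rightarrow> bool" where
  "two_sheeted_covering X p S \<longleftrightarrow>
     covering_space X p S \<and> (\<forall>b\<in>S. card (X \<inter> p -` {b}) = 2)"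

end

theory Submission
  imports Defs
begin

text \<open>
  A unimodal fibre function is strictly quasiconvex and attains its infimum exactly at its only
  critical point, so \<open>A\<^sub>E\<close> is the closed set where the least energy is at most \<open>E\<close> and \<open>D\<^sub>E\<close> is
  where it equals \<open>E\<close>.  The set where it is below \<open>E\<close> is open; hence the boundary lies in \<open>D\<^sub>E\<close>.
  A point of \<open>D\<^sub>E\<close> in the interior of \<open>A\<^sub>E\<close> would be a local maximum of the least energy, which
  regularity of \<open>E\<close> excludes.  Near a base point with least energy below \<open>E\<close>, one and the same
  fibre coordinate \<open>m\<close> separates the two roots of \<open>h\<^sub>b = E\<close>, and the roots on either side of \<open>m\<close>
  form the two sheets.
\<close>

locale unimodal_hamiltonian =
  fixes H :: hamiltonian
  assumes continuous: "continuous_on UNIV H"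
    and coercive: "coercive_fibres H"
    and unimodal: "unimodal_fibres H"
begin

section \<open>Shape, minimum and roots of a single fibre function\<close>

lemma continuous_on_fibre_fun [continuous_intros]:
  fixes f :: "'a::topological_space \<Rightarrow> real \<times> real"
  assumes "continuous_on S f" "continuous_on S g"
  shows "continuous_on S (\<lambda>x. fibre_fun H (f x) (g x))"
  unfolding fibre_fun_def
  by (rule continuous_on_compose2[OF continuous]) (auto intro!: continuous_intros assms)

text \<open>This turns the derivative signs of (U) into strict monotonicity on two closed
  half-lines; continuity of the derivative makes their common endpoint the one critical
  point.\<close>

lemma fibre_fun_shape:
  obtains m where
    "strict_antimono_on {..m} (fibre_fun H b)"
    "strict_mono_on {m..} (fibre_fun H b)"
    "\<forall>p. (fibre_fun H b has_real_derivative 0) (at p) \<longleftrightarrow> p = m"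
proof -
  let ?h = "fibre_fun H b"
  note unimodal_b = unimodal[unfolded unimodal_fibres_def, THEN spec, of b]
  obtain D where D: "\<And>x. (?h has_real_derivative D x) (at x)" "continuous_on UNIV D"
    using unimodal_b
    by (auto simp: C1_differentiable_on_def has_real_derivative_iff_has_vector_derivative)
  have "\<exists>m. (\<forall>p<m. deriv ?h p < 0) \<and> (\<forall>p>m. deriv ?h p > 0)"
    using unimodal_b[THEN conjunct2] by (rule ex1_implies_ex)
  moreover have "deriv ?h p = D p" for p
    using D(1) by (rule DERIV_imp_deriv)
  ultimately obtain m where m: "\<And>x. x < m \<Longrightarrow> D x < 0" "\<And>x. m < x \<Longrightarrow> D x > 0"
    by auto
  \<comment> \<open>(U) gives no sign at \<open>m\<close> itself; the one-sided limits of the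
    continuous \<open>D\<close> force \<open>D m \<le> 0\<close> from the left and
    \<open>0 \<le> D m\<close> from the right.\<close>
  have lim: "(D \<longlongrightarrow> D m) (at m within S)" for S
    using D(2) by (simp add: continuous_on_eq_continuous_at continuous_at_imp_continuous_at_within
        flip: continuous_within)
  have "\<forall>\<^sub>F x in at_left m. D x \<le> 0"
    using m(1) by (auto simp: eventually_at intro!: exI[of _ 1] less_imp_le)
  then have "D m \<le> 0"
    by (rule tendsto_upperbound[OF lim]) simp
  moreover have "\<forall>\<^sub>F x in at_right m. 0 \<le> D x"
    using m(2) by (auto simp: eventually_at intro!: exI[of _ 1] less_imp_le)
  then have "0 \<le> D m"
    by (rule tendsto_lowerbound[OF lim]) simp
  ultimately have Dm: "D m = 0" by simp
  have cont: "continuous_on S ?h" for S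
    by (intro continuous_intros)
  show ?thesis
  proof
    have "?h y < ?h x" if "x < y" "y \<le> m" for x y
      using that m D(1) by (intro DERIV_neg_imp_decreasing_open[OF _ _ cont]) force+
    then show "strict_antimono_on {..m} ?h"
      by (auto intro: monotone_onI)
    have "?h x < ?h y" if "m \<le> x" "x < y" for x y
      using that m D(1) by (intro DERIV_pos_imp_increasing_open[OF _ _ cont]) force+
    then show "strict_mono_on {m..} ?h"
      by (auto intro: monotone_onI)
    show "\<forall>p. (?h has_real_derivative 0) (at p) \<longleftrightarrow> p = m"
      by (metis D(1) Dm DERIV_unique m less_irrefl linorder_neqE)
  qed
qed

text \<open>Strict quasiconvexity: \<open>y\<close> is compared with \<open>x\<close> on the
  decreasing branch or with \<open>z\<close> on the increasing one. Since the minimiser is absent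
  from the statement, its dependence on \<open>b\<close> never has to be controlled.\<close>

lemma fibre_fun_between:
  assumes "x < y" "y < z"
  shows "fibre_fun H b y < max (fibre_fun H b x) (fibre_fun H b z)"
proof -
  obtain m where dec: "strict_antimono_on {..m} (fibre_fun H b)"
    and inc: "strict_mono_on {m..} (fibre_fun H b)"
    by (rule fibre_fun_shape[of b])
  show ?thesis
    using assms monotone_onD[OF dec, of x y] monotone_onD[OF inc, of y z]
    by (cases "y \<le> m") auto
qed

text \<open>The turning point is the strict minimiser, so the infimum is a minimum, and being
  critical means attaining it.\<close>

lemma
  shows least_energy_attained: "\<exists>m. fibre_fun H b m = least_energy H b"
    and least_energy_le: "least_energy H b \<le> fibre_fun H b p"
    and critical_iff: "(fibre_fun H b has_real_derivative 0) (at p)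
      \<longleftrightarrow> fibre_fun H b p = least_energy H b"
proof -
  obtain m where dec: "strict_antimono_on {..m} (fibre_fun H b)"
    and inc: "strict_mono_on {m..} (fibre_fun H b)"
    and crit: "\<forall>p. (fibre_fun H b has_real_derivative 0) (at p) \<longleftrightarrow> p = m"
    by (rule fibre_fun_shape[of b])
  have less: "fibre_fun H b m < fibre_fun H b p" if "p \<noteq> m" for p
    using that monotone_onD[OF dec, of p m] monotone_onD[OF inc, of m p] by fastforce
  have le: "fibre_fun H b m \<le> fibre_fun H b p" for p
    using less[of p] by (cases "p = m") auto
  have eq: "least_energy H b = fibre_fun H b m"
    unfolding least_energy_def using le by (intro cInf_eq_minimum) auto
  then show "\<exists>m. fibre_fun H b m = least_energy H b" by auto
  show "least_energy H b \<le> fibre_fun H b p"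
    unfolding eq by (rule le)
  show "(fibre_fun H b has_real_derivative 0) (at p) \<longleftrightarrow> fibre_fun H b p = least_energy H b"
    unfolding eq crit[rule_format] using less[of p] by (cases "p = m") simp_all
qed

text \<open>Coercivity pushes the fibre function above \<open>E\<close> along each ray from
  \<open>m\<close>, and the intermediate value theorem gives a root. The sign \<open>s\<close>
  treats both rays at once.\<close>

lemma fibre_root:
  assumes "s = 1 \<or> s = -1" "fibre_fun H b m < E"
  obtains r where "0 < r" "fibre_fun H b (m + s * r) = E"
proof -
  obtain R where R: "\<And>p. \<bar>p\<bar> > R \<Longrightarrow> fibre_fun H b p > E"
    using coercive[unfolded coercive_fibres_def, THEN spec, of b] by blast
  \<comment> \<open>By the triangle inequality \<open>m + s * ?t\<close> has absolute value at least
    \<open>\<bar>R\<bar> + 1\<close>, for either sign.\<close>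
  let ?t = "\<bar>R\<bar> + \<bar>m\<bar> + 1"
  have "fibre_fun H b (m + s * ?t) > E"
    using assms(1) by (intro R) auto
  moreover have "continuous_on {0..?t} (\<lambda>t. fibre_fun H b (m + s * t))"
    by (intro continuous_intros)
  ultimately obtain r where "0 \<le> r" "fibre_fun H b (m + s * r) = E"
    using assms(2) IVT'[of "\<lambda>t. fibre_fun H b (m + s * t)" 0 E ?t] by auto
  then show ?thesis
    using that[of r] assms(2) by (cases "r = 0") auto
qed

text \<open>Before the root, the point lies between two values at most \<open>E\<close>, so
  quasiconvexity puts it below \<open>E\<close>; past the root, the root lies between
  \<open>m\<close> and the point, so the larger of their values exceeds \<open>E\<close>. Hence each
  ray carries only one root, and comparing \<open>t\<close> with \<open>r\<close> becomes a strict
  inequality on the fibre function.\<close>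

lemma fibre_below_iff:
  assumes "s = 1 \<or> s = -1" "fibre_fun H b m < E" "0 < r" "fibre_fun H b (m + s * r) = E" "0 < t"
  shows "fibre_fun H b (m + s * t) < E \<longleftrightarrow> t < r"
    and "E < fibre_fun H b (m + s * t) \<longleftrightarrow> r < t"
proof -
  have "fibre_fun H b (m + s * t) < E" if "t < r"
    using assms that fibre_fun_between[of m "m + t" "m + r" b]
      fibre_fun_between[of "m - r" "m - t" m b] by auto
  moreover have "E < fibre_fun H b (m + s * t)" if "r < t"
    using assms that fibre_fun_between[of m "m + r" "m + t" b]
      fibre_fun_between[of "m - t" "m - r" m b] by auto
  ultimately show "fibre_fun H b (m + s * t) < E \<longleftrightarrow> t < r"
    and "E < fibre_fun H b (m + s * t) \<longleftrightarrow> r < t"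
    using assms(4) by (cases t r rule: linorder_cases; force)+
qed

section \<open>The admissible region and the discriminant in terms of the least energy\<close>

lemma admissible_eq: "admissible H E = {b. least_energy H b \<le> E}"
proof (intro set_eqI iffI)
  fix b assume "b \<in> admissible H E"
  then show "b \<in> {b. least_energy H b \<le> E}"
    by (auto simp: admissible_def energy_slice_def base_proj_def least_energy_le)
next
  fix b assume b: "b \<in> {b. least_energy H b \<le> E}"
  obtain m where m: "fibre_fun H b m = least_energy H b"
    using least_energy_attained by blast
  have "\<exists>p. fibre_fun H b p = E"
  \<comment> \<open>At equality the minimiser is already a root; below \<open>E\<close> a root lies
    on the ray to its right.\<close>
  proof (cases "least_energy H b = E")
    case False
    then show ?thesis using b m fibre_root[of 1 b m E] by auto
  qed (use m in auto)
  then show "b \<in> admissible H E"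
    by (cases b) (force simp: admissible_def energy_slice_def base_proj_def)
qed

lemma discriminant_eq: "discriminant H E = {b. least_energy H b = E}"
proof (intro set_eqI iffI)
  fix b assume "b \<in> discriminant H E"
  then show "b \<in> {b. least_energy H b = E}"
    by (auto simp: discriminant_def crit_locus_def energy_slice_def base_proj_def critical_iff)
next
  fix b assume b: "b \<in> {b. least_energy H b = E}"
  obtain m where "fibre_fun H b m = least_energy H b"
    using least_energy_attained by blast
  with b show "b \<in> discriminant H E"
    by (cases b)
      (force simp: discriminant_def crit_locus_def energy_slice_def base_proj_def critical_iff)
qed

lemma open_fibre_below: "open {b. fibre_fun H b p < E}"
  by (intro open_Collect_less continuous_intros)

text \<open>Upper semicontinuity of a pointwise infimum of continuous functions of
  \<open>b\<close>.\<close>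

lemma open_least_energy_less: "open {b. least_energy H b < E}"
proof -
  have "{b. least_energy H b < E} = (\<Union>p. {b. fibre_fun H b p < E})"
    using least_energy_attained
    by (auto intro: le_less_trans[OF least_energy_le]) metis
  then show ?thesis
    using open_fibre_below by auto
qed

text \<open>Lower semicontinuity: locally uniform coercivity confines the fibre coordinates with
  values at most \<open>E\<close> to one compact interval, where a tube argument applies.\<close>

lemma closed_least_energy_le: "closed {b. least_energy H b \<le> E}"
proof -
  have "\<exists>T. open T \<and> b0 \<in> T \<and> T \<subseteq> - {b. least_energy H b \<le> E}"
    if b0: "b0 \<in> - {b. least_energy H b \<le> E}" for b0
  proof -
    obtain N R where N: "open N" "b0 \<in> N" "\<And>b p. b \<in> N \<Longrightarrow> \<bar>p\<bar> > R \<Longrightarrow> fibre_fun H b p > E"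
      using coercive[unfolded coercive_fibres_def, THEN spec, of b0] by blast
    let ?W = "{z. E < fibre_fun H (fst z) (snd z)}"
    have "open ?W"
      by (intro open_Collect_less continuous_intros)
    moreover have "{b0} \<times> {-R..R} \<subseteq> ?W"
      using b0 by (auto intro: less_le_trans[OF _ least_energy_le])
    ultimately obtain T where T: "open T" "b0 \<in> T" "T \<times> {-R..R} \<subseteq> ?W"
      using Elementary_Topology.tube_lemma[of "{-R..R}" ?W b0] by auto
    have "E < fibre_fun H b p" if "b \<in> N \<inter> T" for b p
      using that N(3)[of b p] subsetD[OF T(3), of "(b, p)"]
      by (cases "\<bar>p\<bar> > R") (auto simp: not_less abs_le_iff)
    \<comment> \<open>The strict bound on all values passes to the infimum because the infimum is
      attained.\<close>
    then have "E < least_energy H b" if "b \<in> N \<inter> T" for b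
      using that least_energy_attained[of b] by metis
    then have "N \<inter> T \<subseteq> - {b. least_energy H b \<le> E}"
      by force
    then show ?thesis
      using N T by blast
  qed
  then show ?thesis
    unfolding closed_def by (subst open_subopen) blast
qed

lemma frontier_admissible: "frontier (admissible H E) \<subseteq> discriminant H E"
proof -
  have "{b. least_energy H b < E} \<subseteq> interior (admissible H E)"
    by (intro interior_maximal open_least_energy_less) (auto simp: admissible_eq)
  then show ?thesis
    using closed_least_energy_le[of E]
    by (force simp: frontier_def admissible_eq discriminant_eq)
qed

lemma discriminant_subset_frontier:
  assumes "regular_value (least_energy H) E"
  shows "discriminant H E \<subseteq> frontier (admissible H E)"
proof
  fix b assume "b \<in> discriminant H E"
  then have b: "least_energy H b = E" by (simp add: discriminant_eq)
  obtain D where D: "(least_energy H has_derivative D) (at b)" "D \<noteq> (\<lambda>v. 0)"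
    using assms b unfolding regular_value_def by blast
  have "b \<notin> interior (admissible H E)"
  proof
    assume "b \<in> interior (admissible H E)"
    \<comment> \<open>Points near \<open>b\<close> are admissible, so their least energy is at most
      \<open>E\<close>, which is its value at \<open>b\<close>.\<close>
    then have "\<forall>\<^sub>F x in at b. least_energy H x \<le> least_energy H b"
      using b eventually_at_in_open'[of "interior (admissible H E)" b] interior_subset
      by (auto simp: admissible_eq elim!: eventually_mono)
    then have "D = (\<lambda>v. 0)"
      using D(1) has_derivative_local_max by blast
    with D(2) show False by simp
  qed
  then show "b \<in> frontier (admissible H E)"
    using b closure_subset[of "admissible H E"] by (auto simp: frontier_def admissible_eq)
qed

section \<open>The two sheets and the covering\<close>

text \<open>Over \<open>T\<close> the unique root on side \<open>s\<close> of the fixed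
  \<open>m\<close> is a continuous function of \<open>b\<close>; its graph is the sheet, which the
  projection therefore maps homeomorphically.\<close>

lemma homeomorphism_sheet:
  assumes s: "s = 1 \<or> s = -1" and T: "\<And>b. b \<in> T \<Longrightarrow> fibre_fun H b m < E"
  shows "\<exists>q. homeomorphism
    {x \<in> energy_slice H E. base_proj x \<in> T \<and> 0 < s * (fst (snd x) - m)} T base_proj q"
proof -
  have "\<exists>r. 0 < r \<and> fibre_fun H b (m + s * r) = E" if "b \<in> T" for b
    using fibre_root[OF s T[OF that]] by metis
  then obtain r where r: "\<And>b. b \<in> T \<Longrightarrow> 0 < r b" "\<And>b. b \<in> T \<Longrightarrow> fibre_fun H b (m + s * r b) = E"
    by metis
  note iff = fibre_below_iff[OF s T r(1) r(2)]
  have ev: "\<forall>\<^sub>F b in at b0 within T. fibre_fun H b p < E" if "fibre_fun H b0 p < E" for b0 p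
    using that by (intro eventually_at_topological[THEN iffD2] exI[of _ "{b. fibre_fun H b p < E}"])
      (auto intro: open_fibre_below)
  have ev': "\<forall>\<^sub>F b in at b0 within T. E < fibre_fun H b p" if "E < fibre_fun H b0 p" for b0 p
    using that by (intro eventually_at_topological[THEN iffD2] exI[of _ "{b. E < fibre_fun H b p}"])
      (auto intro!: open_Collect_less continuous_intros)
  have inT: "\<forall>\<^sub>F b in at b0 within T. b \<in> T" for b0
    by (auto simp: eventually_at_filter)
  \<comment> \<open>For \<open>a > 0\<close>, the conditions \<open>a < r b\<close> and
    \<open>r b < a\<close> say that the fibre function at \<open>m + s * a\<close> is below or above
    \<open>E\<close>. With the fibre coordinate fixed, these are open conditions on
    \<open>b\<close>.\<close>
  have cont: "continuous_on T r"
    unfolding continuous_on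
  proof (intro ballI order_tendstoI)
    fix b0 a assume b0: "b0 \<in> T" and a: "a < r b0"
    show "\<forall>\<^sub>F b in at b0 within T. a < r b"
    proof (cases "0 < a")
      case True
      have "fibre_fun H b0 (m + s * a) < E"
        using iff(1)[of b0 a] b0 True a by blast
      from ev[OF this] inT show ?thesis
        by eventually_elim (use iff(1) True in blast)
    next
      case False
      from inT show ?thesis
        by eventually_elim (use r(1) False in force)
    qed
  next
    fix b0 a assume b0: "b0 \<in> T" and a: "r b0 < a"
    then have pos: "0 < a" using r(1)[of b0] by simp
    have "E < fibre_fun H b0 (m + s * a)"
      using iff(2)[of b0 a] b0 pos a by blast
    from ev'[OF this] inT show "\<forall>\<^sub>F b in at b0 within T. r b < a"
      by eventually_elim (use iff(2) pos in blast)
  qed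
  let ?X = "{x \<in> energy_slice H E. base_proj x \<in> T \<and> 0 < s * (fst (snd x) - m)}"
  have "homeomorphism ?X T base_proj (\<lambda>b. (fst b, m + s * r b, snd b))"
  proof (rule homeomorphismI)
    show "continuous_on ?X base_proj"
      unfolding base_proj_def case_prod_unfold by (intro continuous_intros)
    show "continuous_on T (\<lambda>b. (fst b, m + s * r b, snd b))"
      by (intro continuous_intros cont)
    show "base_proj ` ?X \<subseteq> T" by auto
    show "(\<lambda>b. (fst b, m + s * r b, snd b)) ` T \<subseteq> ?X"
      using s r by (auto simp: energy_slice_def base_proj_def)
    show "base_proj (fst b, m + s * r b, snd b) = b" for b
      by (simp add: base_proj_def)
    fix x assume "x \<in> ?X"
    then obtain q2 p p2 where x: "x = (q2, p, p2)" "(q2, p2) \<in> T"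
      "fibre_fun H (q2, p2) p = E" "0 < s * (p - m)"
      by (cases x) (auto simp: energy_slice_def base_proj_def)
    \<comment> \<open>As \<open>s * s = 1\<close>, the positive distance \<open>s * (p - m)\<close>
      recovers \<open>p\<close>, and uniqueness of the root identifies it with
      \<open>r\<close>.\<close>
    have p: "p = m + s * (s * (p - m))" using s by auto
    have "r (q2, p2) = s * (p - m)"
      using iff[OF x(2) x(2) x(2) x(4)] x(3) p by (metis less_irrefl linorder_neqE)
    then show "(fst (base_proj x), m + s * r (base_proj x), snd (base_proj x)) = x"
      using p x by (simp add: base_proj_def)
  qed
  then show ?thesis by blast
qed

lemma card_fibre:
  assumes "least_energy H b < E"
  shows "card (energy_slice H E \<inter> base_proj -` {b}) = 2"
proof -
  obtain m where m: "fibre_fun H b m < E"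
    using assms least_energy_attained[of b] by metis
  obtain r where r: "0 < r" "fibre_fun H b (m + 1 * r) = E"
    using fibre_root[of 1] m by blast
  obtain l where l: "0 < l" "fibre_fun H b (m + -1 * l) = E"
    using fibre_root[of "-1"] m by blast
  have "p = m + r \<or> p = m - l" if p: "fibre_fun H b p = E" for p
  proof (cases "p > m")
    case True
    then show ?thesis using fibre_below_iff[OF _ m r, of "p - m"] p by auto
  next
    case False
    then have "p < m" using p m by (cases "p = m") auto
    then show ?thesis using fibre_below_iff[OF _ m l, of "m - p"] p by auto
  qed
  then have "energy_slice H E \<inter> base_proj -` {b}
      = {(fst b, m + r, snd b), (fst b, m - l, snd b)}"
    using r l by (auto simp: energy_slice_def base_proj_def)
  then show ?thesis using r l by simp
qed

lemma two_sheeted_covering_below: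
  assumes "\<And>b. b \<in> S \<Longrightarrow> least_energy H b < E"
  shows "two_sheeted_covering (energy_slice H E \<inter> base_proj -` S) base_proj S"
  unfolding two_sheeted_covering_def covering_space_def
proof (intro conjI ballI)
  let ?X = "energy_slice H E \<inter> base_proj -` S"
  have card: "card (?X \<inter> base_proj -` {b}) = 2" if "b \<in> S" for b
  proof -
    have "?X \<inter> base_proj -` {b} = energy_slice H E \<inter> base_proj -` {b}"
      using that by auto
    then show ?thesis using card_fibre assms that by simp
  qed
  then show "card (?X \<inter> base_proj -` {b}) = 2" if "b \<in> S" for b
    using that .
  have cont: "continuous_on A base_proj" for A
    unfolding base_proj_def case_prod_unfold by (intro continuous_intros)
  then show "continuous_on ?X base_proj" .
  have "?X \<inter> base_proj -` {b} \<noteq> {}" if "b \<in> S" for b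
    using card[OF that] by (metis card.empty zero_neq_numeral)
  then show "base_proj ` ?X = S" by blast
  fix b assume b: "b \<in> S"
  obtain m where m: "fibre_fun H b m < E"
    using assms[OF b] least_energy_attained[of b] by metis
  \<comment> \<open>This is the evenly covered neighbourhood: \<open>m\<close>, chosen for the one
    base point \<open>b\<close>, stays strictly between the two roots throughout
    \<open>?T\<close>.\<close>
  let ?T = "S \<inter> {b. fibre_fun H b m < E}"
  define sheet where
    "sheet s = {x \<in> energy_slice H E. base_proj x \<in> ?T \<and> 0 < s * (fst (snd x) - m)}" for s
  \<comment> \<open>Over \<open>?T\<close> the value at \<open>m\<close> is below \<open>E\<close>,
    so no slice point has fibre coordinate \<open>m\<close> and the two sheets exhaust the
    preimage.\<close>
  have ne: "fst (snd x) \<noteq> m" if "x \<in> ?X \<inter> base_proj -` ?T" for x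
    using that by (auto simp: energy_slice_def base_proj_def)
  have "x \<in> \<Union>{sheet 1, sheet (-1)} \<longleftrightarrow> x \<in> ?X \<inter> base_proj -` ?T" for x
    using ne[of x] by (auto simp: sheet_def)
  then have "\<Union>{sheet 1, sheet (-1)} = ?X \<inter> base_proj -` ?T"
    by (rule set_eqI)
  moreover have "openin (top_of_set ?X) (sheet s)" for s
  proof -
    have "sheet s = ?X \<inter> (base_proj -` {b. fibre_fun H b m < E} \<inter> {x. 0 < s * (fst (snd x) - m)})"
      by (auto simp: sheet_def)
    moreover have "open (base_proj -` {b. fibre_fun H b m < E} \<inter> {x. 0 < s * (fst (snd x) - m)})"
      by (intro open_Int open_vimage open_fibre_below cont open_Collect_less continuous_intros)
    ultimately show ?thesis by (simp add: openin_open_Int)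
  qed
  moreover have "pairwise disjnt {sheet 1, sheet (-1)}"
    by (auto simp: pairwise_insert disjnt_def sheet_def)
  moreover have "\<exists>q. homeomorphism (sheet s) ?T base_proj q" if "s = 1 \<or> s = -1" for s
    unfolding sheet_def by (rule homeomorphism_sheet[OF that]) auto
  moreover have "openin (top_of_set S) ?T"
    by (simp add: open_fibre_below openin_open_Int)
  ultimately show "\<exists>T. b \<in> T \<and> openin (top_of_set S) T \<and>
      (\<exists>v. \<Union>v = ?X \<inter> base_proj -` T \<and> (\<forall>u\<in>v. openin (top_of_set ?X) u) \<and>
        pairwise disjnt v \<and> (\<forall>u\<in>v. \<exists>q. homeomorphism u T base_proj q))"
    using b m by (intro exI[of _ ?T] conjI exI[of _ "{sheet 1, sheet (-1)}"]) auto
qed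

end

section \<open>A Hamiltonian with constant least energy\<close>

text \<open>All fibres are the same parabola. At \<open>E = 0\<close> every base point is therefore
  both admissible and in the discriminant, while the frontier is empty.\<close>

lemma square_counterexample:
  defines "H \<equiv> (\<lambda>(q1, q2, p1, p2). p1\<^sup>2) :: hamiltonian"
  shows "unimodal_hamiltonian H" "least_energy H = (\<lambda>b. 0)"
proof -
  have fib: "fibre_fun H b = (\<lambda>p. p\<^sup>2)" for b
    by (simp add: fun_eq_iff fibre_fun_def H_def)
  have der: "((\<lambda>p. p\<^sup>2) has_real_derivative 2 * p) (at p)" for p :: real
    by (auto intro!: derivative_eq_intros)
  have "deriv (\<lambda>p::real. p\<^sup>2) p = 2 * p" for p
    using der by (rule DERIV_imp_deriv)
  moreover have "\<exists>!m::real. (\<forall>p<m. 2 * p < 0) \<and> (\<forall>p>m. 2 * p > 0)"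
  proof (rule ex1I[of _ 0])
    fix m :: real assume m: "(\<forall>p<m. 2 * p < 0) \<and> (\<forall>p>m. 2 * p > 0)"
    \<comment> \<open>Otherwise a point strictly between \<open>0\<close> and \<open>m\<close> would
      violate one of the sign conditions.\<close>
    then show "m = 0"
      using dense[of 0 m] dense[of m 0] by (cases m "0::real" rule: linorder_cases) force+
  qed auto
  moreover have "(\<lambda>p::real. p\<^sup>2) C1_differentiable_on UNIV"
    unfolding C1_differentiable_on_def
    by (rule exI[of _ "\<lambda>p. 2 * p"])
      (auto intro!: continuous_intros der
         simp flip: has_real_derivative_iff_has_vector_derivative)
  ultimately have "unimodal_fibres H"
    by (simp add: unimodal_fibres_def fib)
  moreover have "coercive_fibres H"
    unfolding coercive_fibres_def fib
  proof (intro allI exI[of _ UNIV] conjI)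
    fix M :: real
    have "M < p\<^sup>2" if "\<bar>p\<bar> > \<bar>M\<bar> + 1" for p :: real
    proof -
      have "M < 1 * \<bar>p\<bar>" using that by simp
      also have "\<dots> \<le> \<bar>p\<bar> * \<bar>p\<bar>" using that by (intro mult_right_mono) auto
      finally show ?thesis by (simp add: power2_eq_square)
    qed
    then show "\<exists>R. \<forall>b\<in>UNIV. \<forall>p. R < \<bar>p\<bar> \<longrightarrow> M < p\<^sup>2" by blast
  qed auto
  moreover have "continuous_on UNIV H"
    unfolding H_def case_prod_unfold by (intro continuous_intros)
  ultimately show "unimodal_hamiltonian H"
    by unfold_locales
  show "least_energy H = (\<lambda>b. 0)"
    by (auto simp: fun_eq_iff least_energy_def fib intro!: cInf_eq_minimum)
qed

theorem theorem4p8: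
  shows
    "(\<forall>(H :: real \<times> real \<times> real \<times> real \<Rightarrow> real) (E :: real).
        continuous_on UNIV H \<and> coercive_fibres H \<and> unimodal_fibres H \<longrightarrow>
          (frontier (admissible H E) \<subseteq> discriminant H E \<and>
           discriminant H E = {b. least_energy H b = E}) \<and>
          ((\<exists>U. open U \<and> frontier (admissible H E) \<subseteq> U \<and> C1_on_open (least_energy H) U) \<and>
           regular_value (least_energy H) E \<longrightarrow>
             {b. least_energy H b < E} = interior (admissible H E) \<and>
             discriminant H E = frontier (admissible H E) \<and>
             frontier (admissible H E) = {b. least_energy H b = E} \<and>
             two_sheeted_covering
               (energy_slice H E \<inter> base_proj -` interior (admissible H E))
               base_proj
               (interior (admissible H E))))
     \<and>
     (\<exists>(H :: real \<times> real \<times> real \<times> real \<Rightarrow> real) (E :: real).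
        continuous_on UNIV H \<and> coercive_fibres H \<and> unimodal_fibres H \<and>
        C1_on_open (least_energy H) UNIV \<and>
        \<not> regular_value (least_energy H) E \<and>
        discriminant H E \<noteq> frontier (admissible H E) \<and>
        discriminant H E \<inter> interior (admissible H E) \<noteq> {})"
proof (intro conjI allI impI; (elim conjE)?)
  fix H :: hamiltonian and E
  assume "continuous_on UNIV H" "coercive_fibres H" "unimodal_fibres H"
  then interpret unimodal_hamiltonian H by unfold_locales
  show "frontier (admissible H E) \<subseteq> discriminant H E"
    by (rule frontier_admissible)
  show "discriminant H E = {b. least_energy H b = E}"
    by (rule discriminant_eq)
  assume reg: "regular_value (least_energy H) E"
  show D: "discriminant H E = frontier (admissible H E)"
    using frontier_admissible discriminant_subset_frontier[OF reg] by blast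
  then show "frontier (admissible H E) = {b. least_energy H b = E}"
    by (simp add: discriminant_eq)
  \<comment> \<open>Removing the frontier, now known to be the level set \<open>E\<close> of the
    least energy, leaves the strict sublevel set.\<close>
  have "interior (admissible H E) = admissible H E - frontier (admissible H E)"
    using interior_subset closure_subset by (fastforce simp: frontier_def)
  also have "\<dots> = {b. least_energy H b < E}"
    unfolding D[symmetric] by (auto simp: admissible_eq discriminant_eq)
  finally show int: "{b. least_energy H b < E} = interior (admissible H E)" ..
  show "two_sheeted_covering (energy_slice H E \<inter> base_proj -` interior (admissible H E))
      base_proj (interior (admissible H E))"
    by (rule two_sheeted_covering_below) (simp flip: int)
next
  define H :: hamiltonian where "H = (\<lambda>(q1, q2, p1, p2). p1\<^sup>2)"
  interpret unimodal_hamiltonian H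
    unfolding H_def by (rule square_counterexample)
  have least: "least_energy H = (\<lambda>b. 0)"
    unfolding H_def by (rule square_counterexample)
  have "C1_on_open (least_energy H) UNIV"
    unfolding C1_on_open_def least by (intro exI[of _ "\<lambda>x. 0"]) (auto simp: zero_blinfun.rep_eq)
  moreover have "\<not> regular_value (least_energy H) 0"
    unfolding regular_value_def least
    by (auto intro: has_derivative_unique has_derivative_const)
  moreover have "admissible H 0 = UNIV" "discriminant H 0 = UNIV"
    by (auto simp: admissible_eq discriminant_eq least)
  ultimately show "\<exists>(H :: hamiltonian) E.
      continuous_on UNIV H \<and> coercive_fibres H \<and> unimodal_fibres H \<and>
      C1_on_open (least_energy H) UNIV \<and> \<not> regular_value (least_energy H) E \<and>
      discriminant H E \<noteq> frontier (admissible H E) \<and>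
      discriminant H E \<inter> interior (admissible H E) \<noteq> {}"
    using continuous coercive unimodal by (intro exI[of _ H] exI[of _ 0]) auto
qed

end
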